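(* Every unit disk graph has dot product dimension at most $3$.
   Context: Graphs are finite and simple. A unit disk graph is the intersection graph of a finite collection of unit-size (i.e. equal-size, closed) disks in the plane: the vertices are the disks, and two distinct vertices are adjacent if and only if the corresponding disks intersect. A graph $G=(V,E)$ has a $d$-dot product representation if there are vectors $\mathbf{a}^u\in\mathbb{R}^d$ ($u\in V$) and a threshold $t>0$ such that, for all distinct $u,v\in V$, $uv\in E$ if and only if $\mathbf{a}^u\cdot\mathbf{a}^v\ge t$. The dot product dimension of $G$ is the smallest $d\geq 1$ such that $G$ has a $d$-dot product representation. *)

theory Defs
  imports
    "HOL-Analysis.Analysis"
    "Graph_Theory.Pair_Digraph"
    "Jordan_Normal_Form.Matrix"
begin

text \<open>
  Finite simple graphs are rendered by \<^locale>\<open>pair_graph\<close>: finite vertex set, and a finite,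
  symmetric, irreflexive set of arcs (u, v), so that the edge uv is the pair of arcs (u, v), (v, u).
\<close>

text \<open>
  The disk of vertex u is \<^term>\<open>cball (c u) r\<close>. The disks form an indexed family, so two
  vertices may have the same disk; the case of pairwise distinct disks is that of an injective c.
\<close>

definition unit_disk_graph :: "'a pair_pre_digraph \<Rightarrow> bool" where
  "unit_disk_graph G \<longleftrightarrow> pair_graph G \<and>
     (\<exists>(c :: 'a \<Rightarrow> real ^ 2) r. r > 0 \<and>
        (\<forall>u \<in> pverts G. \<forall>v \<in> pverts G. u \<noteq> v \<longrightarrow>
           ((u, v) \<in> parcs G \<longleftrightarrow> cball (c u) r \<inter> cball (c v) r \<noteq> {})))"

definition has_dot_product_representation :: "'a pair_pre_digraph \<Rightarrow> nat \<Rightarrow> bool" where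
  "has_dot_product_representation G d \<longleftrightarrow>
     (\<exists>a (t :: real). t > 0 \<and> (\<forall>u \<in> pverts G. a u \<in> carrier_vec d) \<and>
        (\<forall>u \<in> pverts G. \<forall>v \<in> pverts G. u \<noteq> v \<longrightarrow>
           ((u, v) \<in> parcs G \<longleftrightarrow> scalar_prod (a u) (a v) \<ge> t)))"

definition dot_product_dimension :: "'a pair_pre_digraph \<Rightarrow> nat" where
  "dot_product_dimension G = (LEAST d. d \<ge> 1 \<and> has_dot_product_representation G d)"

text \<open>
  Every finite simple graph has a representation (the rows of its incidence matrix, with
  threshold 1), so the \<open>LEAST\<close> above is never taken over the empty set.
\<close>

lemma ex_dot_product_representation:
  assumes "pair_graph G"
  shows "\<exists>d \<ge> 1. has_dot_product_representation G d"
proof -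
  interpret pair_graph G by (rule assms)
  obtain n :: nat and e where e: "parcs G = e ` {i. i < n}"
    using pair_finite_arcs finite_imp_nat_seg_image_inj_on by metis
  define a :: "'a \<Rightarrow> real Matrix.vec" where
    "a u = Matrix.vec (Suc n) (\<lambda>i. if i < n \<and> (u = fst (e i) \<or> u = snd (e i)) then 1 else 0)" for u
  have "(u, v) \<in> parcs G \<longleftrightarrow> scalar_prod (a u) (a v) \<ge> 1" if "u \<noteq> v" for u v
  proof -
    let ?f = "\<lambda>i. (if i < n \<and> (u = fst (e i) \<or> u = snd (e i)) then 1 else 0) *
                  (if i < n \<and> (v = fst (e i) \<or> v = snd (e i)) then 1 else (0 :: real))"
    have dot: "scalar_prod (a u) (a v) = sum ?f {0..<Suc n}"
      unfolding scalar_prod_def a_def by (auto intro!: sum.cong)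
    show ?thesis
    proof
      assume "(u, v) \<in> parcs G"
      then obtain i where i: "i < n" "e i = (u, v)" using e by force
      have "?f i \<le> sum ?f {0..<Suc n}"
        by (rule member_le_sum) (use i in auto)
      with i show "scalar_prod (a u) (a v) \<ge> 1" unfolding dot by simp
    next
      assume "scalar_prod (a u) (a v) \<ge> 1"
      then have "sum ?f {0..<Suc n} \<noteq> 0" unfolding dot by linarith
      then obtain i where "?f i \<noteq> 0" by (meson sum.neutral)
      then have i: "i < n" "u = fst (e i) \<or> u = snd (e i)" "v = fst (e i) \<or> v = snd (e i)"
        by (auto split: if_splits)
      then have "e i = (u, v) \<or> e i = (v, u)" using that by (metis prod.collapse)
      moreover have "e i \<in> parcs G" using e i by blast
      ultimately show "(u, v) \<in> parcs G" using arcs_symmetric by auto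
    qed
  qed
  then have "has_dot_product_representation G (Suc n)"
    unfolding has_dot_product_representation_def
    by (intro exI[of _ a] exI[of _ 1]) (auto simp: a_def)
  then show ?thesis by (intro exI[of _ "Suc n"]) simp
qed

end

theory Submission
  imports Defs "HOL-Real_Asymp.Real_Asymp"
begin

text \<open>
  Lift the centre p to (p, s - p^2/(2s)), a point of a paraboloid that osculates the sphere of
  radius s. The scalar product of two lifted centres p, q is
  s^2 - |p - q|^2/2 + p^2 q^2/(4s^2). With threshold s^2 - 2r^2, the error term p^2 q^2/(4s^2) only
  helps adjacent pairs, and for s large enough it is smaller than the gap of each of the finitely
  many nonadjacent pairs.
\<close>

text \<open>A common point bounds the distance by the triangle inequality; conversely, the midpoint
  of close centres lies in both balls.\<close>

lemma cball_Int_cball_nonempty_iff: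
  fixes x y :: "'a :: euclidean_space"
  assumes "r \<ge> 0"
  shows "cball x r \<inter> cball y r \<noteq> {} \<longleftrightarrow> dist x y \<le> 2 * r"
proof
  assume "cball x r \<inter> cball y r \<noteq> {}"
  then obtain z where "dist x z \<le> r" "dist y z \<le> r" by auto
  then show "dist x y \<le> 2 * r" using dist_triangle2[of x y z] by linarith
next
  assume "dist x y \<le> 2 * r"
  then have "midpoint x y \<in> cball x r \<inter> cball y r"
    by (simp add: dist_midpoint)
  then show "cball x r \<inter> cball y r \<noteq> {}" by blast
qed

text \<open>The last coordinate is the second-order Taylor polynomial in \<open>p\<close> of
  \<open>sqrt (s\<^sup>2 - (norm p)\<^sup>2)\<close>, the height of the sphere above
  \<open>p\<close>.\<close>

definition paraboloid_lift :: "real \<Rightarrow> real ^ 2 \<Rightarrow> real Matrix.vec" where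
  "paraboloid_lift s p =
     vec_of_list [p $ 1, p $ 2, s - (norm p)\<^sup>2 / (2 * s)]"

lemma paraboloid_lift_carrier: "paraboloid_lift s p \<in> carrier_vec 3"
  unfolding paraboloid_lift_def by (rule carrier_vecI) simp

text \<open>In the product of the heights the factor \<open>s\<close> cancels in the mixed terms,
  and polarization merges what they leave with \<open>p \<bullet> q\<close> into the squared
  distance.\<close>

lemma scalar_prod_paraboloid_lift:
  assumes "s \<noteq> 0"
  shows "scalar_prod (paraboloid_lift s p) (paraboloid_lift s q) =
    s\<^sup>2 - (dist p q)\<^sup>2 / 2 + (norm p)\<^sup>2 * (norm q)\<^sup>2 / (4 * s\<^sup>2)"
proof -
  have "scalar_prod (paraboloid_lift s p) (paraboloid_lift s q) =
      p \<bullet> q + (s - (norm p)\<^sup>2 / (2 * s)) * (s - (norm q)\<^sup>2 / (2 * s))"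
    by (simp add: paraboloid_lift_def scalar_prod_def eval_nat_numeral inner_vec_def
        UNIV_2)
  also have "(s - (norm p)\<^sup>2 / (2 * s)) * (s - (norm q)\<^sup>2 / (2 * s)) =
      s\<^sup>2 - (norm p)\<^sup>2 / 2 - (norm q)\<^sup>2 / 2 + (norm p)\<^sup>2 * (norm q)\<^sup>2 / (4 * s\<^sup>2)"
    using assms by (simp add: field_simps power2_eq_square)
  also have "p \<bullet> q = ((norm p)\<^sup>2 + (norm q)\<^sup>2 - (dist p q)\<^sup>2) / 2"
    by (simp add: dist_norm dot_norm_neg)
  finally show ?thesis by (simp add: field_simps)
qed

text \<open>How large \<open>s\<close> must be depends on the pair; stated with a filter, the claims
  for finitely many pairs combine without explicit bounds.\<close>

lemma eventually_scalar_prod_paraboloid_lift: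
  assumes "r \<ge> 0"
  shows "\<forall>\<^sub>F s in at_top. dist p q \<le> 2 * r \<longleftrightarrow>
    scalar_prod (paraboloid_lift s p) (paraboloid_lift s q) \<ge> s\<^sup>2 - 2 * r\<^sup>2"
proof (cases "dist p q \<le> 2 * r")
  case True
  then have "(dist p q)\<^sup>2 \<le> (2 * r)\<^sup>2" by (intro power_mono) auto
  then have "(dist p q)\<^sup>2 / 2 \<le> 2 * r\<^sup>2" by (simp add: power_mult_distrib)
  moreover have "(norm p)\<^sup>2 * (norm q)\<^sup>2 / (4 * s\<^sup>2) \<ge> 0" for s by simp
  ultimately have "s\<^sup>2 - 2 * r\<^sup>2 \<le>
      s\<^sup>2 - (dist p q)\<^sup>2 / 2 + (norm p)\<^sup>2 * (norm q)\<^sup>2 / (4 * s\<^sup>2)" for s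
    by (smt (verit))
  \<comment> \<open>For a close pair any \<open>s > 0\<close> works; positivity only serves to give
    \<open>s \<noteq> 0\<close> in the product formula.\<close>
  with True show ?thesis
    by (intro eventually_mono[OF eventually_gt_at_top[of 0]])
      (simp add: scalar_prod_paraboloid_lift)
next
  case False
  with assms have "(2 * r)\<^sup>2 < (dist p q)\<^sup>2" by (intro power_strict_mono) auto
  \<comment> \<open>This is how far the product without its error term stays below the threshold; it
    does not depend on \<open>s\<close>, so the vanishing error eventually drops below it.\<close>
  then have gap: "0 < (dist p q)\<^sup>2 / 2 - 2 * r\<^sup>2" by (simp add: power_mult_distrib)
  have "((\<lambda>s. (norm p)\<^sup>2 * (norm q)\<^sup>2 / (4 * s\<^sup>2)) \<longlongrightarrow> 0) at_top"
    by real_asymp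
  from order_tendstoD(2)[OF this gap] show ?thesis
    using eventually_gt_at_top[of 0]
    by eventually_elim (use False in \<open>simp add: scalar_prod_paraboloid_lift\<close>)
qed

theorem corollary1:
  fixes G :: "'a pair_pre_digraph"
  assumes "unit_disk_graph G"
  shows "dot_product_dimension G \<le> 3"
proof -
  from assms obtain c :: "'a \<Rightarrow> real ^ 2" and r where "pair_graph G" and r: "r > 0"
    and adj: "\<And>u v. u \<in> pverts G \<Longrightarrow> v \<in> pverts G \<Longrightarrow> u \<noteq> v \<Longrightarrow>
      (u, v) \<in> parcs G \<longleftrightarrow> dist (c u) (c v) \<le> 2 * r"
    unfolding unit_disk_graph_def by (auto simp: cball_Int_cball_nonempty_iff)
  interpret pair_graph G by fact
  \<comment> \<open>Finiteness of \<open>pverts G\<close> moves the filter quantifier outside, so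
    one \<open>s\<close> serves all pairs.\<close>
  have "\<forall>\<^sub>F s in at_top. \<forall>u \<in> pverts G. \<forall>v \<in> pverts G. dist (c u) (c v) \<le> 2 * r \<longleftrightarrow>
      scalar_prod (paraboloid_lift s (c u)) (paraboloid_lift s (c v)) \<ge> s\<^sup>2 - 2 * r\<^sup>2"
    using r by (simp add: eventually_ball_finite_distrib eventually_scalar_prod_paraboloid_lift)
  \<comment> \<open>A representation requires a positive threshold.\<close>
  moreover have "\<forall>\<^sub>F s in at_top. s\<^sup>2 - 2 * r\<^sup>2 > 0"
    by real_asymp
  ultimately obtain s where
    "\<forall>u \<in> pverts G. \<forall>v \<in> pverts G. dist (c u) (c v) \<le> 2 * r \<longleftrightarrow>
      scalar_prod (paraboloid_lift s (c u)) (paraboloid_lift s (c v)) \<ge> s\<^sup>2 - 2 * r\<^sup>2"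
    "s\<^sup>2 - 2 * r\<^sup>2 > 0"
    using eventually_happens'[OF trivial_limit_at_top_linorder eventually_conj] by blast
  then have "has_dot_product_representation G 3"
    unfolding has_dot_product_representation_def
    by (intro exI[of _ "\<lambda>u. paraboloid_lift s (c u)"] exI[of _ "s\<^sup>2 - 2 * r\<^sup>2"])
      (simp add: adj paraboloid_lift_carrier)
  then show ?thesis unfolding dot_product_dimension_def by (intro Least_le) simp
qed

end
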